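(* Let $P$ be a partially ordered set and $R$ a commutative unital ring. There is a one-to-one correspondence between the $R$-bilinear antisymmetric biderivations $B$ of $\tilde I(P,R)$ with values in $FI(P,R)$ and the maps $\sigma:P^2_<\to R$ which are constant on chains. More precisely, the correspondence is given by $$B(f,g)(x,y)=\begin{cases}0, & x=y,\\ \sigma(x,y)\,[f,g](x,y), & x<y,\end{cases}$$ for all $f,g\in\tilde I(P,R)$ and all $x\le y$ in $P$, where $[f,g]=fg-gf$.
   Context: Let $(P,\le)$ be a poset and $R$ a commutative unital ring. $I(P,R)$ is the $R$-module of formal sums $f=\sum_{x\le y}f(x,y)e_{xy}$ with $f(x,y)\in R$, where $e_{xy}$ is a symbol attached to each pair $x\le y$ in $P$. Such $f$ is a finitary series if for every $x<y$ in $P$ there are only finitely many pairs $u,v\in P$ with $x\le u<v\le y$ and $f(u,v)\ne 0$. $FI(P,R)\subseteq I(P,R)$ is the set of finitary series; it is an associative unital $R$-algebra under $(fg)(x,y)=\sum_{x\le z\le y}f(x,z)g(z,y)$. Identify $e_{xy}$ with $1_Re_{xy}\in FI(P,R)$ and let $E=\{e_{xy}\mid x\le y\}$. $\tilde I(P,R)$ is the subalgebra of $FI(P,R)$ generated by $E$, i.e. the $R$-linear span of $E$; $FI(P,R)$ is regarded as an $\tilde I(P,R)$-bimodule via multiplication. For an associative ring $A$ and an $A$-bimodule $M$, a biderivation of $A$ with values in $M$ is a biadditive map $B:A\times A\to M$ with $B(ab,c)=B(a,c)b+aB(b,c)$ and $B(a,bc)=B(a,b)c+bB(a,c)$ for all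 $a,b,c\in A$; it is antisymmetric if $B(a,a)=0$ for all $a\in A$. $P^2_<=\{(x,y)\in P^2\mid x<y\}$. A map $\sigma:P^2_<\to R$ is constant on chains if for every chain $C\subseteq P$ and all $x<y$, $u<v$ in $C$ one has $\sigma(x,y)=\sigma(u,v)$. *)

theory Defs
  imports Main "HOL-Library.FuncSet" "HOL-Library.Function_Algebras"
begin

text \<open>
  The poset is a type \<open>'p\<close> of class \<open>order\<close>. The coefficient ring has sort
  \<open>{comm_ring, monoid_mult}\<close> rather than \<open>comm_ring_1\<close>, because the latter
  excludes the zero ring. A formal sum is its coefficient function, extended by 0 to the pairs
  with \<open>\<not> x \<le> y\<close>. Addition of formal sums is pointwise (Function_Algebras); the
  pointwise \<open>*\<close> on functions provided by the same theory is not used, the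
  product being \<open>conv\<close> below.
\<close>

type_synonym ('p, 'r) series = "'p \<Rightarrow> 'p \<Rightarrow> 'r"

definition incidence_series :: "('p::order, 'r::zero) series set" where
  "incidence_series = {f. \<forall>x y. f x y \<noteq> 0 \<longrightarrow> x \<le> y}"

definition finitary_series :: "('p::order, 'r::zero) series set" where
  "finitary_series = {f \<in> incidence_series. \<forall>x y. x < y \<longrightarrow>
     finite {(u, v). x \<le> u \<and> u < v \<and> v \<le> y \<and> f u v \<noteq> 0}}"

text \<open>
  Intervals of the poset may be infinite, and \<open>sum\<close> over an infinite set is 0 by
  convention; so the sum ranges over the nonzero terms only. For finitary series there are
  finitely many of them, see \<open>finite_conv_support\<close>.
\<close>

definition conv :: "('p::order, 'r::comm_ring) series \<Rightarrow> ('p, 'r) series \<Rightarrow> ('p, 'r) series"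
    (infixl \<open>\<star>\<close> 70) where
  "f \<star> g = (\<lambda>x y. \<Sum>z | x \<le> z \<and> z \<le> y \<and> f x z * g z y \<noteq> 0. f x z * g z y)"

lemma finite_conv_support:
  fixes f g :: "('p::order, 'r::comm_ring) series"
  assumes "f \<in> finitary_series"
  shows "finite {z. x \<le> z \<and> z \<le> y \<and> f x z * g z y \<noteq> 0}"
proof (cases "x < y")
  case True
  then have "finite {(u, v). x \<le> u \<and> u < v \<and> v \<le> y \<and> f u v \<noteq> 0}"
    using assms by (auto simp: finitary_series_def)
  then have "finite (insert x (snd ` {(u, v). x \<le> u \<and> u < v \<and> v \<le> y \<and> f u v \<noteq> 0}))"
    by simp
  moreover have "{z. x \<le> z \<and> z \<le> y \<and> f x z * g z y \<noteq> 0}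
      \<subseteq> insert x (snd ` {(u, v). x \<le> u \<and> u < v \<and> v \<le> y \<and> f u v \<noteq> 0})"
    by (force simp: image_iff order_le_less)
  ultimately show ?thesis by (rule rev_finite_subset)
next
  case False
  then have "{z. x \<le> z \<and> z \<le> y \<and> f x z * g z y \<noteq> 0} \<subseteq> {x}"
    by (auto intro: order.antisym dest: order_trans simp: order_le_less)
  then show ?thesis by (rule finite_subset) simp
qed

definition commutator :: "('p::order, 'r::comm_ring) series \<Rightarrow> ('p, 'r) series \<Rightarrow> ('p, 'r) series"
  where "commutator f g = f \<star> g - g \<star> f"

definition scale :: "'r::comm_ring \<Rightarrow> ('p::order, 'r) series \<Rightarrow> ('p, 'r) series" where
  "scale r f = (\<lambda>x y. r * f x y)"

definition unit_series ::
    "'p::order \<Rightarrow> 'p \<Rightarrow> ('p, 'r::{comm_ring,monoid_mult}) series" where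
  "unit_series x y = (\<lambda>u v. if u = x \<and> v = y then 1 else 0)"

text \<open>
  The subalgebra generated by the \<open>unit_series x y\<close> with \<open>x \<le> y\<close>, i.e. their linear
  span. It need not contain the identity of the algebra of finitary series.
\<close>

definition span_series :: "('p::order, 'r::{comm_ring,monoid_mult}) series set" where
  "span_series = {\<Sum>(x, y)\<in>S. scale (c (x, y)) (unit_series x y) | S c.
     finite S \<and> S \<subseteq> {(x, y). x \<le> y}}"

text \<open>
  Biderivations of a ring with carrier \<open>A\<close> and multiplication \<open>mul\<close>, with values in the
  bimodule with carrier \<open>M\<close>, left action \<open>lact\<close> and right action \<open>ract\<close>.
\<close>

definition biderivation ::
    "'a set \<Rightarrow> ('a::ab_group_add \<Rightarrow> 'a \<Rightarrow> 'a) \<Rightarrow>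
     'm set \<Rightarrow> ('a \<Rightarrow> 'm::ab_group_add \<Rightarrow> 'm) \<Rightarrow> ('m \<Rightarrow> 'a \<Rightarrow> 'm) \<Rightarrow>
     ('a \<times> 'a \<Rightarrow> 'm) \<Rightarrow> bool" where
  "biderivation A mul M lact ract B \<longleftrightarrow>
     B \<in> A \<times> A \<rightarrow> M \<and>
     (\<forall>a\<in>A. \<forall>b\<in>A. \<forall>c\<in>A.
        B (a + b, c) = B (a, c) + B (b, c) \<and>
        B (a, b + c) = B (a, b) + B (a, c) \<and>
        B (mul a b, c) = ract (B (a, c)) b + lact a (B (b, c)) \<and>
        B (a, mul b c) = ract (B (a, b)) c + lact b (B (a, c)))"

definition antisymmetric_on :: "'a set \<Rightarrow> ('a \<times> 'a \<Rightarrow> 'm::zero) \<Rightarrow> bool" where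
  "antisymmetric_on A B \<longleftrightarrow> (\<forall>a\<in>A. B (a, a) = 0)"

definition bilinear_on ::
    "('p::order, 'r::comm_ring) series set \<Rightarrow>
     (('p, 'r) series \<times> ('p, 'r) series \<Rightarrow> ('p, 'r) series) \<Rightarrow> bool" where
  "bilinear_on A B \<longleftrightarrow>
     (\<forall>f\<in>A. \<forall>g\<in>A. \<forall>h\<in>A.
        B (f + g, h) = B (f, h) + B (g, h) \<and> B (f, g + h) = B (f, g) + B (f, h)) \<and>
     (\<forall>r. \<forall>f\<in>A. \<forall>g\<in>A.
        B (scale r f, g) = scale r (B (f, g)) \<and> B (f, scale r g) = scale r (B (f, g)))"

definition strict_pairs :: "('p::order \<times> 'p) set" where
  "strict_pairs = {(x, y). x < y}"

definition constant_on_chains :: "('p::order \<times> 'p \<Rightarrow> 'r) \<Rightarrow> bool" where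
  "constant_on_chains \<sigma> \<longleftrightarrow>
     (\<forall>C. Complete_Partial_Order.chain (\<le>) C \<longrightarrow>
        (\<forall>x\<in>C. \<forall>y\<in>C. \<forall>u\<in>C. \<forall>v\<in>C. x < y \<longrightarrow> u < v \<longrightarrow> \<sigma> (x, y) = \<sigma> (u, v)))"

end

(*
  For an antisymmetric biderivation B of a ring A, expanding B(ac,bd) in two ways gives
  Bresar's identity B(a,b) x [c,d] = [a,b] x B(c,d). With matrix units in place of a, b and x it
  forces B(f,g)(p,q) = \<sigma> [f,g](p,q) as soon as p is not minimal or q is not maximal, where
  \<sigma>(x,y) = B(e_xx,e_xy)(x,y); it also makes \<sigma> constant on chains. Subtracting the
  biderivation attached to \<sigma> leaves one that can be nonzero only at pairs p \<le> q with
  p minimal and q maximal. Such a pair interacts with no other, so the value there is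
  determined by the values on the units e_pp and e_pq, which vanish.
*)
theory Submission
  imports Defs
begin

section \<open>The algebra of finitary series\<close>

lemma incidence_seriesD: "f \<in> incidence_series \<Longrightarrow> \<not> x \<le> y \<Longrightarrow> f x y = 0"
  by (auto simp: incidence_series_def)

lemma incidence_seriesI: "(\<And>x y. \<not> x \<le> y \<Longrightarrow> f x y = 0) \<Longrightarrow> f \<in> incidence_series"
  by (auto simp: incidence_series_def)

lemma finitary_imp_incidence [simp]: "f \<in> finitary_series \<Longrightarrow> f \<in> incidence_series"
  by (simp add: finitary_series_def)

text \<open>The definition speaks only of \<open>x < y\<close>; in all other cases the set is empty
  by transitivity. Later arguments thus need no case distinction on the interval.\<close>

lemma finite_finitary_support:
  "f \<in> finitary_series \<Longrightarrow> finite {(u, v). x \<le> u \<and> u < v \<and> v \<le> y \<and> f u v \<noteq> 0}"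
proof (cases "x < y")
  case True
  then show "f \<in> finitary_series \<Longrightarrow> finite {(u, v). x \<le> u \<and> u < v \<and> v \<le> y \<and> f u v \<noteq> 0}"
    unfolding finitary_series_def by blast
next
  case False
  have "\<not> (x \<le> u \<and> u < v \<and> v \<le> y \<and> f u v \<noteq> 0)" for u v
  proof
    assume "x \<le> u \<and> u < v \<and> v \<le> y \<and> f u v \<noteq> 0"
    then have "x < y" by (meson order.strict_trans1 order.strict_trans2)
    with False show False ..
  qed
  then show "finite {(u, v). x \<le> u \<and> u < v \<and> v \<le> y \<and> f u v \<noteq> 0}"
    by (simp only: case_prod_unfold simp_thms) simp
qed

lemma finitary_seriesI:
  "f \<in> incidence_series \<Longrightarrow>
    (\<And>x y. finite {(u, v). x \<le> u \<and> u < v \<and> v \<le> y \<and> f u v \<noteq> 0}) \<Longrightarrow> f \<in> finitary_series"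
  unfolding finitary_series_def by blast

text \<open>The sum in \<open>conv\<close> runs over a set that varies with the factors and the
  arguments. Passing to a larger finite \<open>T\<close> lets several products be expanded over one
  index set. Elements of \<open>T\<close> outside the interval contribute 0 because the factors are
  incidence series.\<close>

lemma conv_eq_sum:
  fixes f g :: "('p::order, 'r::comm_ring) series"
  assumes "f \<in> incidence_series" "g \<in> incidence_series" "finite T"
    and "\<And>z. x \<le> z \<Longrightarrow> z \<le> y \<Longrightarrow> f x z \<noteq> 0 \<Longrightarrow> g z y \<noteq> 0 \<Longrightarrow> z \<in> T"
  shows "(f \<star> g) x y = (\<Sum>z\<in>T. f x z * g z y)"
  unfolding conv_def
proof (rule sum.mono_neutral_left)
  have "f x z = 0 \<or> g z y = 0 \<Longrightarrow> f x z * g z y = 0" for z by auto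
  then show "{z. x \<le> z \<and> z \<le> y \<and> f x z * g z y \<noteq> 0} \<subseteq> T"
    using assms(4) by blast
  show "\<forall>z\<in>T - {z. x \<le> z \<and> z \<le> y \<and> f x z * g z y \<noteq> 0}. f x z * g z y = 0"
    using incidence_seriesD[OF assms(1)] incidence_seriesD[OF assms(2)] by fastforce
qed (fact assms(3))

text \<open>A finite index set over which all products involving \<open>f\<close> at pairs inside
  the interval can be expanded. The ends \<open>x\<close> and \<open>y\<close> are put in by hand
  because terms with a diagonal factor \<open>f x x\<close> or \<open>f y y\<close> are not seen by
  the strict pairs.\<close>

definition endpoints :: "('p::order, 'r::zero) series \<Rightarrow> 'p \<Rightarrow> 'p \<Rightarrow> 'p set" where
  "endpoints f x y = {x, y} \<union> (let S = {(u, v). x \<le> u \<and> u < v \<and> v \<le> y \<and> f u v \<noteq> 0}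
     in fst ` S \<union> snd ` S)"

lemma finite_endpoints: "f \<in> finitary_series \<Longrightarrow> finite (endpoints f x y)"
  by (simp add: endpoints_def Let_def finite_finitary_support)

lemma endpointsI:
  "x \<le> u \<Longrightarrow> u < v \<Longrightarrow> v \<le> y \<Longrightarrow> f u v \<noteq> 0 \<Longrightarrow> u \<in> endpoints f x y \<and> v \<in> endpoints f x y"
  by (force simp: endpoints_def Let_def image_iff)

lemma endpoints_bounds: "x \<le> y \<Longrightarrow> z \<in> endpoints f x y \<Longrightarrow> x \<le> z \<and> z \<le> y"
  by (auto simp: endpoints_def Let_def)

lemma endpoints_ends: "x \<in> endpoints f x y" "y \<in> endpoints f x y"
  by (auto simp: endpoints_def)

text \<open>If a contributing \<open>z\<close> differs from \<open>u\<close>, then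
  \<open>(u, z)\<close> is a strict pair where \<open>f\<close> is nonzero; if it differs from
  \<open>v\<close>, the same holds for \<open>(z, v)\<close> and \<open>g\<close>. As
  \<open>u\<close> and \<open>v\<close> are in \<open>T\<close>, it suffices to have the endpoints
  of one of the two factors in \<open>T\<close>.\<close>

lemma conv_eq_sum_endpoints:
  fixes f g :: "('p::order, 'r::comm_ring) series"
  assumes "f \<in> incidence_series" "g \<in> incidence_series" "finite T"
    and "x \<le> u" "v \<le> y" "u \<in> T" "v \<in> T"
    and "endpoints f x y \<subseteq> T \<or> endpoints g x y \<subseteq> T"
  shows "(f \<star> g) u v = (\<Sum>z\<in>T. f u z * g z v)"
proof (rule conv_eq_sum)
  fix z assume z: "u \<le> z" "z \<le> v" "f u z \<noteq> 0" "g z v \<noteq> 0"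
  then have "x \<le> z" "z \<le> y" using assms(4,5) by auto
  then have "z = u \<or> z \<in> endpoints f x y" "z = v \<or> z \<in> endpoints g x y"
    using endpointsI[of x u z y f] endpointsI[of x z v y g] z assms(4,5) by (auto simp: order_le_less)
  then show "z \<in> T" using assms(6-8) by auto
qed (use assms in auto)

section \<open>Closure under convolution and associativity\<close>

lemma incidence_conv [simp]: "f \<star> g \<in> incidence_series"
proof (rule incidence_seriesI)
  show "(f \<star> g) x y = 0" if "\<not> x \<le> y" for x y
    using that by (auto simp: conv_def intro!: sum.neutral)
qed

lemma conv_nonzeroE:
  assumes "(f \<star> g) x y \<noteq> 0"
  obtains z where "x \<le> z" "z \<le> y" "f x z \<noteq> 0" "g z y \<noteq> 0"
proof -
  have "{z. x \<le> z \<and> z \<le> y \<and> f x z * g z y \<noteq> 0} \<noteq> {}"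
    using assms unfolding conv_def by (metis sum.empty)
  then obtain z where z: "x \<le> z" "z \<le> y" "f x z * g z y \<noteq> 0" by auto
  moreover from z(3) have "f x z \<noteq> 0" "g z y \<noteq> 0" by auto
  ultimately show ?thesis using that by blast
qed

text \<open>A nonzero value at \<open>u < v\<close> comes from some \<open>z\<close> between them.
  Each nontrivial step from \<open>u\<close> to \<open>z\<close> or from \<open>z\<close> to
  \<open>v\<close> has its ends among the endpoints of \<open>f\<close> or \<open>g\<close>, and at
  least one step is nontrivial. So both \<open>u\<close> and \<open>v\<close> lie in the finite set
  \<open>?T\<close>.\<close>

lemma finitary_conv [simp]:
  fixes f g :: "('p::order, 'r::comm_ring) series"
  assumes "f \<in> finitary_series" "g \<in> finitary_series"
  shows "f \<star> g \<in> finitary_series"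
proof -
  have "finite {(u, v). x \<le> u \<and> u < v \<and> v \<le> y \<and> (f \<star> g) u v \<noteq> 0}" for x y
  proof (rule finite_subset)
    let ?T = "endpoints f x y \<union> endpoints g x y"
    show "{(u, v). x \<le> u \<and> u < v \<and> v \<le> y \<and> (f \<star> g) u v \<noteq> 0} \<subseteq> ?T \<times> ?T"
    proof (rule subsetI, elim CollectE case_prodE conjE, simp only:)
      fix u v assume uv: "x \<le> u" "u < v" "v \<le> y" "(f \<star> g) u v \<noteq> 0"
      then obtain z where z: "u \<le> z" "z \<le> v" "f u z \<noteq> 0" "g z v \<noteq> 0" by (blast elim: conv_nonzeroE)
      have "x \<le> z" "z \<le> y" using uv z by auto
      then have "z \<noteq> u \<longrightarrow> u \<in> endpoints f x y \<and> z \<in> endpoints f x y"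
          "z \<noteq> v \<longrightarrow> z \<in> endpoints g x y \<and> v \<in> endpoints g x y"
        using endpointsI[of x u z y f] endpointsI[of x z v y g] z uv by (auto simp: order_le_less)
      then show "(u, v) \<in> ?T \<times> ?T" using uv(2) by auto
    qed
    show "finite (?T \<times> ?T)" using assms by (simp add: finite_endpoints)
  qed
  then show ?thesis by (intro finitary_seriesI incidence_conv)
qed

text \<open>Over the union \<open>T\<close> of the three endpoint sets, the outer products and the
  inner ones (taken at pairs from \<open>T\<close>) are all finite sums indexed by \<open>T\<close>.
  What remains is associativity of the matrix product, that is \<open>sum.swap\<close>.\<close>

lemma conv_assoc:
  fixes f g h :: "('p::order, 'r::comm_ring) series"
  assumes "f \<in> finitary_series" "g \<in> finitary_series" "h \<in> finitary_series"
  shows "(f \<star> g) \<star> h = f \<star> (g \<star> h)"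
proof (intro ext)
  fix x y
  show "((f \<star> g) \<star> h) x y = (f \<star> (g \<star> h)) x y"
  proof (cases "x \<le> y")
    case True
    define T where "T = endpoints f x y \<union> endpoints g x y \<union> endpoints h x y"
    have fin: "finite T" using assms by (simp add: T_def finite_endpoints)
    have T: "x \<le> z" "z \<le> y" if "z \<in> T" for z
      using that True endpoints_bounds unfolding T_def by blast+
    have ends: "x \<in> T" "y \<in> T" by (auto simp: T_def endpoints_ends)
    have sub: "endpoints f x y \<subseteq> T" "endpoints g x y \<subseteq> T" "endpoints h x y \<subseteq> T"
      by (auto simp: T_def)
    have "((f \<star> g) \<star> h) x y = (\<Sum>z\<in>T. (f \<star> g) x z * h z y)"
      by (rule conv_eq_sum_endpoints[where x = x and y = y]) (use assms fin ends sub in auto)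
    also have "\<dots> = (\<Sum>z\<in>T. (\<Sum>w\<in>T. f x w * g w z) * h z y)"
    proof (rule sum.cong[OF refl])
      fix z assume "z \<in> T"
      then have "(f \<star> g) x z = (\<Sum>w\<in>T. f x w * g w z)"
        by (intro conv_eq_sum_endpoints[where x = x and y = y]) (use assms fin ends sub T in auto)
      then show "(f \<star> g) x z * h z y = (\<Sum>w\<in>T. f x w * g w z) * h z y" by simp
    qed
    also have "\<dots> = (\<Sum>w\<in>T. f x w * (\<Sum>z\<in>T. g w z * h z y))"
      by (simp add: sum_distrib_left sum_distrib_right mult.assoc) (rule sum.swap)
    also have "\<dots> = (\<Sum>w\<in>T. f x w * (g \<star> h) w y)"
    proof (rule sum.cong[OF refl])
      fix w assume "w \<in> T"
      then have "(g \<star> h) w y = (\<Sum>z\<in>T. g w z * h z y)"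
        by (intro conv_eq_sum_endpoints[where x = x and y = y]) (use assms fin ends sub T in auto)
      then show "f x w * (\<Sum>z\<in>T. g w z * h z y) = f x w * (g \<star> h) w y" by simp
    qed
    also have "\<dots> = (f \<star> (g \<star> h)) x y"
      by (rule conv_eq_sum_endpoints[where x = x and y = y, symmetric]) (use assms fin ends sub in auto)
    finally show ?thesis .
  next
    case False
    then show ?thesis by (simp add: incidence_seriesD)
  qed
qed

section \<open>Additive structure and bilinearity of convolution\<close>

lemma incidence_diff [simp]:
  fixes f g :: "('p::order, 'r::comm_ring) series"
  shows "f \<in> incidence_series \<Longrightarrow> g \<in> incidence_series \<Longrightarrow> f - g \<in> incidence_series"
  by (rule incidence_seriesI) (simp add: incidence_seriesD)

lemma finitary_diff [simp]:
  fixes f g :: "('p::order, 'r::comm_ring) series"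
  assumes "f \<in> finitary_series" "g \<in> finitary_series"
  shows "f - g \<in> finitary_series"
proof -
  have "finite {(u, v). x \<le> u \<and> u < v \<and> v \<le> y \<and> (f - g) u v \<noteq> 0}" for x y
  proof (rule finite_subset)
    show "{(u, v). x \<le> u \<and> u < v \<and> v \<le> y \<and> (f - g) u v \<noteq> 0}
        \<subseteq> {(u, v). x \<le> u \<and> u < v \<and> v \<le> y \<and> f u v \<noteq> 0}
        \<union> {(u, v). x \<le> u \<and> u < v \<and> v \<le> y \<and> g u v \<noteq> 0}" by auto
    show "finite \<dots>" using assms by (intro finite_UnI finite_finitary_support)
  qed
  moreover have "f - g \<in> incidence_series" using assms by simp
  ultimately show ?thesis by (rule finitary_seriesI[rotated])
qed

lemma finitary_zero [simp]: "0 \<in> finitary_series"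
  by (simp add: finitary_series_def incidence_series_def)

lemma finitary_add [simp]:
  fixes f g :: "('p::order, 'r::comm_ring) series"
  assumes "f \<in> finitary_series" "g \<in> finitary_series"
  shows "f + g \<in> finitary_series"
  using finitary_diff[OF assms(1) finitary_diff[OF finitary_zero assms(2)]] by simp

text \<open>Expanding over the endpoints of the common factor \<open>f\<close> gives the products
  with \<open>g\<close>, \<open>h\<close> and \<open>g - h\<close> the same index set.\<close>

lemma conv_diff_right:
  fixes f g h :: "('p::order, 'r::comm_ring) series"
  assumes "f \<in> finitary_series" "g \<in> finitary_series" "h \<in> finitary_series"
  shows "f \<star> (g - h) = f \<star> g - f \<star> h"
proof (intro ext)
  fix x y
  have "(f \<star> k) x y = (\<Sum>z\<in>endpoints f x y. f x z * k z y)" if "k \<in> finitary_series" for k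
    by (rule conv_eq_sum_endpoints[where x = x and y = y])
      (use assms that in \<open>auto simp: finite_endpoints endpoints_ends\<close>)
  then show "(f \<star> (g - h)) x y = (f \<star> g - f \<star> h) x y"
    using assms by (simp add: right_diff_distrib sum_subtractf)
qed

lemma conv_diff_left:
  fixes f g h :: "('p::order, 'r::comm_ring) series"
  assumes "f \<in> finitary_series" "g \<in> finitary_series" "h \<in> finitary_series"
  shows "(f - g) \<star> h = f \<star> h - g \<star> h"
proof (intro ext)
  fix x y
  have "(k \<star> h) x y = (\<Sum>z\<in>endpoints h x y. k x z * h z y)" if "k \<in> finitary_series" for k
    by (rule conv_eq_sum_endpoints[where x = x and y = y])
      (use assms that in \<open>auto simp: finite_endpoints endpoints_ends\<close>)
  then show "((f - g) \<star> h) x y = (f \<star> h - g \<star> h) x y"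
    using assms by (simp add: left_diff_distrib sum_subtractf)
qed

lemma conv_zero [simp]: "f \<star> 0 = 0" "0 \<star> f = 0"
  by (auto simp: conv_def fun_eq_iff)

lemma conv_add_right:
  fixes f g h :: "('p::order, 'r::comm_ring) series"
  assumes "f \<in> finitary_series" "g \<in> finitary_series" "h \<in> finitary_series"
  shows "f \<star> (g + h) = f \<star> g + f \<star> h"
  using conv_diff_right[of f "g + h" h] assms by simp

lemma conv_add_left:
  fixes f g h :: "('p::order, 'r::comm_ring) series"
  assumes "f \<in> finitary_series" "g \<in> finitary_series" "h \<in> finitary_series"
  shows "(f + g) \<star> h = f \<star> h + g \<star> h"
  using conv_diff_left[of "f + g" g h] assms by simp

lemmas conv_distribs = conv_add_left conv_add_right conv_diff_left conv_diff_right

lemma conv_scale: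
  fixes f g :: "('p::order, 'r::comm_ring) series"
  assumes "f \<in> finitary_series" "g \<in> finitary_series"
  shows "scale r f \<star> g = scale r (f \<star> g)" "f \<star> scale r g = scale r (f \<star> g)"
proof -
  have incidence: "scale r k \<in> incidence_series"
    if "k \<in> finitary_series" for k :: "('p, 'r) series"
    using finitary_imp_incidence[OF that]
    by (intro incidence_seriesI) (simp add: scale_def incidence_seriesD)
  \<comment> \<open>The index set contains the endpoints of both \<open>f\<close> and
    \<open>g\<close>, so one unscaled factor is enough. The scaled factor only has to be an
    incidence series.\<close>
  have eq: "(k \<star> l) x y = (\<Sum>z\<in>endpoints f x y \<union> endpoints g x y. k x z * l z y)"
    if "k \<in> incidence_series" "l \<in> incidence_series" "k = f \<or> l = g" for k l x y
    by (rule conv_eq_sum_endpoints[where x = x and y = y])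
      (use assms that in \<open>auto simp: finite_endpoints endpoints_ends\<close>)
  show "scale r f \<star> g = scale r (f \<star> g)" "f \<star> scale r g = scale r (f \<star> g)"
    by (simp_all add: fun_eq_iff eq incidence assms)
       (simp_all add: scale_def fun_eq_iff eq assms sum_distrib_left mult.assoc mult.left_commute)
qed

section \<open>Series of finite support\<close>

lemma unit_series_apply [simp]: "unit_series x y u v = (if u = x \<and> v = y then 1 else 0)"
  by (simp add: unit_series_def)

lemma sum_series_apply: "(\<Sum>i\<in>S. F i) x y = (\<Sum>i\<in>S. F i x y)"
  for F :: "'i \<Rightarrow> 'p \<Rightarrow> 'p \<Rightarrow> 'r::comm_monoid_add"
  by (induction S rule: infinite_finite_induct) auto

text \<open>Distinct units have disjoint supports, so the value of a linear combination at a pair is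
  the coefficient there; conversely, the support of \<open>f\<close> serves as \<open>S\<close>.
  Membership in the span is handled through finite supports from here on.\<close>

lemma span_series_iff:
  fixes f :: "('p::order, 'r::{comm_ring,monoid_mult}) series"
  shows "f \<in> span_series \<longleftrightarrow> f \<in> incidence_series \<and> finite {(x, y). f x y \<noteq> 0}"
proof
  have *: "(\<Sum>(x, y)\<in>S. scale (c (x, y)) (unit_series x y)) u v = (if (u, v) \<in> S then c (u, v) else 0)"
    if "finite S" for S and c :: "'p \<times> 'p \<Rightarrow> 'r" and u v
  proof -
    have "(\<Sum>(x, y)\<in>S. scale (c (x, y)) (unit_series x y)) u v
        = (\<Sum>p\<in>S. if p = (u, v) then c p else 0)"
      unfolding sum_series_apply
      by (rule sum.cong) (auto simp: scale_def split: if_splits)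
    then show ?thesis using that by simp
  qed
  {
    assume "f \<in> span_series"
    then obtain S c where S: "finite S" "S \<subseteq> {(x, y). x \<le> y}"
      and f: "f = (\<Sum>(x, y)\<in>S. scale (c (x, y)) (unit_series x y))"
      unfolding span_series_def by auto
    have f: "f u v = (if (u, v) \<in> S then c (u, v) else 0)" for u v
      unfolding f by (rule *[OF S(1)])
    have "{(x, y). f x y \<noteq> 0} \<subseteq> S" by (auto simp: f split: if_splits)
    with S show "f \<in> incidence_series \<and> finite {(x, y). f x y \<noteq> 0}"
      by (auto simp: incidence_series_def dest: finite_subset)
  next
    assume f: "f \<in> incidence_series \<and> finite {(x, y). f x y \<noteq> 0}"
    let ?S = "{(x, y). f x y \<noteq> 0}"
    have "f = (\<Sum>(x, y)\<in>?S. scale (case_prod f (x, y)) (unit_series x y))"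
      by (intro ext, subst *) (use f in auto)
    moreover have "?S \<subseteq> {(x, y). x \<le> y}" using f by (auto simp: incidence_series_def)
    ultimately show "f \<in> span_series" using f unfolding span_series_def by blast
  }
qed

lemma span_imp_finitary [simp]:
  fixes f :: "('p::order, 'r::{comm_ring,monoid_mult}) series"
  assumes "f \<in> span_series"
  shows "f \<in> finitary_series"
proof (rule finitary_seriesI)
  fix x y
  have "{(u, v). x \<le> u \<and> u < v \<and> v \<le> y \<and> f u v \<noteq> 0} \<subseteq> {(u, v). f u v \<noteq> 0}" by blast
  then show "finite {(u, v). x \<le> u \<and> u < v \<and> v \<le> y \<and> f u v \<noteq> 0}"
    using assms unfolding span_series_iff by (blast intro: finite_subset)
qed (use assms in \<open>simp add: span_series_iff\<close>)

lemma finite_span_support: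
  fixes f :: "('p::order, 'r::{comm_ring,monoid_mult}) series"
  shows "f \<in> span_series \<Longrightarrow> finite {(x, y). f x y \<noteq> 0}"
  unfolding span_series_iff by blast

lemma span_seriesI:
  fixes f :: "('p::order, 'r::{comm_ring,monoid_mult}) series"
  assumes "f \<in> incidence_series" "finite S" "\<And>x y. f x y \<noteq> 0 \<Longrightarrow> (x, y) \<in> S"
  shows "f \<in> span_series"
proof -
  have "{(x, y). f x y \<noteq> 0} \<subseteq> S" using assms(3) by blast
  then show ?thesis using assms(1,2) finite_subset unfolding span_series_iff by blast
qed

lemma span_diff [simp]:
  fixes f g :: "('p::order, 'r::{comm_ring,monoid_mult}) series"
  assumes "f \<in> span_series" "g \<in> span_series"
  shows "f - g \<in> span_series"
proof (rule span_seriesI)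
  show "finite ({(x, y). f x y \<noteq> 0} \<union> {(x, y). g x y \<noteq> 0})"
    using assms by (intro finite_UnI finite_span_support)
qed (use assms in auto)

text \<open>The support of the product lies in the finite rectangle formed by the row indices of
  \<open>f\<close> and the column indices of \<open>g\<close>.\<close>

lemma span_conv [simp]:
  fixes f g :: "('p::order, 'r::{comm_ring,monoid_mult}) series"
  assumes "f \<in> span_series" "g \<in> span_series"
  shows "f \<star> g \<in> span_series"
proof (rule span_seriesI)
  show "finite (fst ` {(x, y). f x y \<noteq> 0} \<times> snd ` {(x, y). g x y \<noteq> 0})"
    using assms by (intro finite_cartesian_product finite_imageI finite_span_support)
  fix x y assume "(f \<star> g) x y \<noteq> 0"
  then obtain z where "f x z \<noteq> 0" "g z y \<noteq> 0" by (rule conv_nonzeroE)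
  then have "x \<in> fst ` {(x, y). f x y \<noteq> 0}" "y \<in> snd ` {(x, y). g x y \<noteq> 0}"
    by (auto intro: rev_image_eqI[of "(x, z)"] rev_image_eqI[of "(z, y)"])
  then show "(x, y) \<in> fst ` {(x, y). f x y \<noteq> 0} \<times> snd ` {(x, y). g x y \<noteq> 0}" by simp
qed simp

lemma span_scale [simp]:
  fixes f :: "('p::order, 'r::{comm_ring,monoid_mult}) series"
  assumes "f \<in> span_series"
  shows "scale r f \<in> span_series"
proof (rule span_seriesI)
  show "scale r f \<in> incidence_series"
    using span_imp_finitary[OF assms] by (intro incidence_seriesI) (simp add: scale_def incidence_seriesD)
  show "finite {(x, y). f x y \<noteq> 0}" using assms by (rule finite_span_support)
qed (auto simp: scale_def)

lemma span_zero [simp]: "0 \<in> span_series"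
  by (simp add: span_series_iff incidence_series_def)

lemma span_add [simp]:
  fixes f g :: "('p::order, 'r::{comm_ring,monoid_mult}) series"
  assumes "f \<in> span_series" "g \<in> span_series"
  shows "f + g \<in> span_series"
  using span_diff[OF assms(1) span_diff[OF span_zero assms(2)]] by simp

lemma span_commutator [simp]:
  "f \<in> span_series \<Longrightarrow> g \<in> span_series \<Longrightarrow> commutator f g \<in> span_series"
  by (simp add: commutator_def)

section \<open>Matrix units and commutators\<close>

lemma incidence_unit [simp]: "x \<le> y \<Longrightarrow> unit_series x y \<in> incidence_series"
  by (rule incidence_seriesI) auto

lemma span_unit [simp]: "x \<le> y \<Longrightarrow> unit_series x y \<in> span_series"
  by (rule span_seriesI[of _ "{(x, y)}"]) (auto split: if_splits)

lemma unit_conv: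
  fixes f :: "('p::order, 'r::{comm_ring,monoid_mult}) series"
  assumes "f \<in> finitary_series" "x \<le> y"
  shows "(unit_series x y \<star> f) u v = (if u = x then f y v else 0)"
proof -
  have "(unit_series x y \<star> f) u v = (\<Sum>z\<in>{y}. unit_series x y u z * f z v)"
    by (rule conv_eq_sum) (use assms in \<open>simp_all split: if_splits\<close>)
  then show ?thesis by simp
qed

lemma conv_unit:
  fixes f :: "('p::order, 'r::{comm_ring,monoid_mult}) series"
  assumes "f \<in> finitary_series" "x \<le> y"
  shows "(f \<star> unit_series x y) u v = (if v = y then f u x else 0)"
proof -
  have "(f \<star> unit_series x y) u v = (\<Sum>z\<in>{x}. f u z * unit_series x y z v)"
    by (rule conv_eq_sum) (use assms in \<open>simp_all split: if_splits\<close>)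
  then show ?thesis by simp
qed

text \<open>A unit between two series separates them: only one term of each sum survives. This turns
  identities between series into scalar identities between single values.\<close>

lemma conv_unit_conv:
  fixes f :: "('p::order, 'r::{comm_ring,monoid_mult}) series"
  assumes "f \<in> finitary_series" "g \<in> finitary_series" "p \<le> q"
  shows "(f \<star> (unit_series p q \<star> g)) x y = f x p * g q y"
proof -
  have "(f \<star> (unit_series p q \<star> g)) x y = (\<Sum>z\<in>{p}. f x z * (unit_series p q \<star> g) z y)"
    by (rule conv_eq_sum) (use assms in \<open>auto simp: unit_conv split: if_splits\<close>)
  then show ?thesis using assms by (simp add: unit_conv)
qed

lemma unit_conv_unit:
  "x \<le> y \<Longrightarrow> u \<le> v \<Longrightarrow> unit_series x y \<star> unit_series u v
    = (if y = u then unit_series x v else (0 :: ('p::order, 'r::{comm_ring,monoid_mult}) series))"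
  by (intro ext) (auto simp: unit_conv)

text \<open>This provides, for each strict pair, a commutator with value 1 there, so that an unknown
  scalar factor can be read off.\<close>

lemma commutator_units:
  "x < y \<Longrightarrow> commutator (unit_series x x) (unit_series x y)
    = (unit_series x y :: ('p::order, 'r::{comm_ring,monoid_mult}) series)"
  by (auto simp: commutator_def unit_conv_unit)

text \<open>The interval is \<open>{x}\<close>, so both products have the value
  \<open>f x x * g x x\<close> there, up to the order of the factors, and the ring is
  commutative.\<close>

lemma commutator_diagonal:
  fixes f g :: "('p::order, 'r::comm_ring) series"
  shows "commutator f g x x = 0"
proof -
  have "{z. x \<le> z \<and> z \<le> x \<and> P z} = (if P x then {x} else {})" for P
    by (cases "P x") (auto dest: order.antisym)
  then have "(f \<star> g) x x = f x x * g x x" for f g :: "('p, 'r) series"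
    by (simp add: conv_def)
  then show ?thesis by (simp add: commutator_def mult.commute)
qed

section \<open>Antisymmetric biderivations\<close>

text \<open>Nothing is demanded off the pairs from \<open>span_series\<close>. Extensionality is
  kept apart because differences do not preserve it: \<open>undefined - undefined\<close> is
  0.\<close>

locale antisymmetric_biderivation =
  fixes B :: "('p::order, 'r::{comm_ring,monoid_mult}) series \<times> ('p, 'r) series \<Rightarrow> ('p, 'r) series"
  assumes bilinear: "bilinear_on span_series B"
    and antisymmetric: "antisymmetric_on span_series B"
    and biderivation: "biderivation span_series (\<star>) finitary_series (\<star>) (\<star>) B"
begin

lemma
  assumes "f \<in> span_series" "g \<in> span_series"
  shows finitary [simp]: "B (f, g) \<in> finitary_series"
    and scale_left: "B (scale r f, g) = scale r (B (f, g))"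
    and scale_right: "B (f, scale r g) = scale r (B (f, g))"
  using assms biderivation bilinear by (auto simp: biderivation_def bilinear_on_def)

lemma self [simp]: "f \<in> span_series \<Longrightarrow> B (f, f) = 0"
  using antisymmetric by (simp add: antisymmetric_on_def)

lemma
  assumes "f \<in> span_series" "g \<in> span_series" "h \<in> span_series"
  shows add_left: "B (f + g, h) = B (f, h) + B (g, h)"
    and add_right: "B (f, g + h) = B (f, g) + B (f, h)"
    and conv_left: "B (f \<star> g, h) = B (f, h) \<star> g + f \<star> B (g, h)"
    and conv_right: "B (f, g \<star> h) = B (f, g) \<star> h + g \<star> B (f, h)"
  using assms biderivation by (auto simp: biderivation_def)

section \<open>Bresar's identity\<close>

lemma swap:
  assumes "f \<in> span_series" "g \<in> span_series"
  shows "B (g, f) = - B (f, g)"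
proof -
  have "B (f + g, f + g) = 0" using assms by simp
  moreover have "B (f + g, f + g) = (B (f, f) + B (g, f)) + (B (f, g) + B (g, g))"
    using assms by (simp only: add_left add_right span_add)
  ultimately have "B (g, f) + B (f, g) = 0" using assms by simp
  then show ?thesis by (simp only: eq_neg_iff_add_eq_0)
qed

lemma zero_left [simp]: "g \<in> span_series \<Longrightarrow> B (0, g) = 0"
  using add_left[of 0 0 g] by simp

text \<open>\<open>B (a \<star> c, b \<star> d)\<close> is expanded starting from the second
  argument, then from the first. The mixed terms with \<open>B (c, b)\<close> and
  \<open>B (a, d)\<close> occur in both expansions and cancel.\<close>

lemma conv_commutator:
  assumes "a \<in> span_series" "b \<in> span_series" "c \<in> span_series" "d \<in> span_series"
  shows "B (a, b) \<star> commutator c d = commutator a b \<star> B (c, d)"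
proof -
  have "B (a \<star> c, b \<star> d) = B (a \<star> c, b) \<star> d + b \<star> B (a \<star> c, d)"
    using assms by (intro conv_right) auto
  then have "B (a \<star> c, b \<star> d) = B (a, b) \<star> (c \<star> d) + a \<star> (B (c, b) \<star> d)
      + (b \<star> (B (a, d) \<star> c) + (b \<star> a) \<star> B (c, d))"
    using assms by (simp add: conv_left conv_distribs conv_assoc)
  moreover have "B (a \<star> c, b \<star> d) = B (a, b \<star> d) \<star> c + a \<star> B (c, b \<star> d)"
    using assms by (intro conv_left) auto
  then have "B (a \<star> c, b \<star> d) = B (a, b) \<star> (d \<star> c) + b \<star> (B (a, d) \<star> c)
      + (a \<star> (B (c, b) \<star> d) + (a \<star> b) \<star> B (c, d))"
    using assms by (simp add: conv_right conv_distribs conv_assoc)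
  ultimately show ?thesis
    using assms by (simp add: commutator_def conv_distribs algebra_simps)
qed

text \<open>Replace \<open>c\<close> by \<open>x \<star> c\<close> in \<open>conv_commutator\<close>
  and expand both sides by the Leibniz rule. The surplus terms agree by
  \<open>conv_commutator\<close> for \<open>x\<close> and \<open>d\<close>, multiplied by
  \<open>c\<close> on the right.\<close>

lemma conv_conv_commutator:
  assumes "a \<in> span_series" "b \<in> span_series" "c \<in> span_series" "d \<in> span_series" "x \<in> span_series"
  shows "B (a, b) \<star> (x \<star> commutator c d) = commutator a b \<star> (x \<star> B (c, d))"
proof -
  have "commutator (x \<star> c) d = x \<star> commutator c d + commutator x d \<star> c"
    using assms by (simp add: commutator_def conv_distribs conv_assoc)
  then have "B (a, b) \<star> (x \<star> commutator c d) + B (a, b) \<star> (commutator x d \<star> c)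
      = B (a, b) \<star> commutator (x \<star> c) d"
    using assms by (simp add: conv_distribs)
  also have "\<dots> = commutator a b \<star> B (x \<star> c, d)"
    using assms by (simp add: conv_commutator)
  also have "\<dots> = commutator a b \<star> (x \<star> B (c, d)) + commutator a b \<star> (B (x, d) \<star> c)"
    using assms by (simp add: conv_left conv_distribs)
  also have "commutator a b \<star> (B (x, d) \<star> c) = B (a, b) \<star> (commutator x d \<star> c)"
    using assms by (simp add: conv_assoc[symmetric] conv_commutator)
  finally show ?thesis by (simp only: add_right_cancel)
qed

text \<open>Bresar's identity with the idempotent \<open>unit_series p p\<close> in the middle, read
  at \<open>(x, y)\<close>.\<close>

lemma mult_commutator:
  assumes "a \<in> span_series" "b \<in> span_series" "c \<in> span_series" "d \<in> span_series"
  shows "B (a, b) x p * commutator c d p y = commutator a b x p * B (c, d) p y"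
  using fun_cong[OF fun_cong[OF conv_conv_commutator[of a b c d "unit_series p p"]], of x y] assms
  by (simp add: conv_unit_conv)

text \<open>The only candidate for \<open>\<sigma>\<close>: the commutator of these two units has
  value 1 at \<open>(x, y)\<close>.\<close>

definition coefficient :: "'p \<Rightarrow> 'p \<Rightarrow> 'r" where
  "coefficient x y = B (unit_series x x, unit_series x y) x y"

text \<open>In \<open>mult_commutator\<close> take the units at \<open>(x, x)\<close> and
  \<open>(x, p)\<close> on the left, whose commutator is 1 at \<open>(x, p)\<close>. The factor
  obtained belongs to the pair \<open>(x, p)\<close> below, not to \<open>(p, y)\<close>. The next
  lemma is the mirror image, with a pair above.\<close>

lemma eval_not_minimal:
  assumes "f \<in> span_series" "g \<in> span_series" "x < p"
  shows "B (f, g) p y = coefficient x p * commutator f g p y"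
  using mult_commutator[of "unit_series x x" "unit_series x p" f g x p y] assms
  by (simp add: commutator_units coefficient_def)

lemma eval_not_maximal:
  assumes "f \<in> span_series" "g \<in> span_series" "q < y"
  shows "B (f, g) x q = coefficient q y * commutator f g x q"
  using mult_commutator[of f g "unit_series q q" "unit_series q y" x q y] assms
  by (simp add: commutator_units coefficient_def mult.commute)

text \<open>\<open>eval_not_minimal\<close> is applied to the very units that define
  \<open>coefficient y z\<close>.\<close>

lemma coefficient_consecutive: "x < y \<Longrightarrow> y < z \<Longrightarrow> coefficient x y = coefficient y z"
  using eval_not_minimal[of "unit_series y y" "unit_series y z" x y z]
  by (simp add: commutator_units coefficient_def[of y z])

text \<open>The unit at \<open>(x, z)\<close> is the product of those at \<open>(x, y)\<close> and
  \<open>(y, z)\<close>. Of the two Leibniz terms at \<open>(x, z)\<close>, the first is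
  \<open>coefficient x y\<close>. The second is a value at \<open>(y, z)\<close>, where
  \<open>y\<close> is not minimal, for two commuting units, hence 0.\<close>

lemma coefficient_extend:
  assumes "x < y" "y < z"
  shows "coefficient x z = coefficient x y"
proof -
  have "x < z" using assms by (rule order.strict_trans)
  let ?e = "unit_series :: 'p \<Rightarrow> 'p \<Rightarrow> ('p, 'r) series"
  have "B (?e x x, ?e x y \<star> ?e y z) = B (?e x x, ?e x y) \<star> ?e y z + ?e x y \<star> B (?e x x, ?e y z)"
    using assms by (intro conv_right) auto
  then have "coefficient x z = coefficient x y + B (?e x x, ?e y z) y z"
    using assms \<open>x < z\<close> by (simp add: unit_conv_unit coefficient_def unit_conv conv_unit)
  moreover have "commutator (?e x x) (?e y z) = 0"
    using assms \<open>x < z\<close> by (auto simp: commutator_def unit_conv_unit)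
  then have "B (?e x x, ?e y z) y z = 0"
    using assms by (simp add: eval_not_minimal[of _ _ x])
  ultimately show ?thesis by simp
qed

text \<open>Within a chain, strict pairs sharing their lower end (\<open>left\<close>) or their
  upper end (\<open>right\<close>) have equal coefficients. Arbitrary pairs \<open>(x, y)\<close>
  and \<open>(u, v)\<close> are linked through \<open>(x, v)\<close> if \<open>x < v\<close>.
  Otherwise \<open>u < v \<le> x < y\<close>, and \<open>(u, y)\<close> links them.\<close>

lemma constant_on_chains_coefficient:
  "constant_on_chains (\<lambda>(x, y)\<in>strict_pairs. coefficient x y)"
proof -
  have extend: "coefficient x z = coefficient x y" if "x < y" "y \<le> z" for x y z
  proof (cases "y = z")
    case False
    with that(2) have "y < z" by (rule order.not_eq_order_implies_strict[rotated])
    with that(1) show ?thesis by (rule coefficient_extend)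
  qed simp
  have left: "coefficient x y = coefficient x z" if "x < y" "x < z" "y \<le> z \<or> z \<le> y" for x y z
    using that(3)
  proof
    show "y \<le> z \<Longrightarrow> ?thesis" by (rule extend[OF that(1), symmetric])
    show "z \<le> y \<Longrightarrow> ?thesis" by (rule extend[OF that(2)])
  qed
  have shrink: "coefficient x z = coefficient y z" if "x \<le> y" "y < z" for x y z
  proof (cases "x = y")
    case False
    with that(1) have "x < y" by (rule order.not_eq_order_implies_strict[rotated])
    then show ?thesis
      using coefficient_extend[of x y z] coefficient_consecutive[of x y z] that(2) by simp
  qed simp
  have right: "coefficient x z = coefficient y z" if "x < z" "y < z" "x \<le> y \<or> y \<le> x" for x y z
    using that(3)
  proof
    show "x \<le> y \<Longrightarrow> ?thesis" by (rule shrink[OF _ that(2)])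
    show "y \<le> x \<Longrightarrow> ?thesis" by (rule shrink[OF _ that(1), symmetric])
  qed
  have chain: "coefficient x y = coefficient u v"
    if "Complete_Partial_Order.chain (\<le>) C" "x \<in> C" "y \<in> C" "u \<in> C" "v \<in> C" "x < y" "u < v"
    for C x y u v
  proof -
    have comp: "a \<le> b \<or> b \<le> a" if "a \<in> C" "b \<in> C" for a b
      using \<open>Complete_Partial_Order.chain (\<le>) C\<close> that by (simp add: chain_def)
    show ?thesis
    proof (cases "x < v")
      case True
      then have "coefficient x y = coefficient x v"
        using that by (intro left comp) auto
      also have "\<dots> = coefficient u v"
        using True that by (intro right comp) auto
      finally show ?thesis .
    next
      case False
      then have "v \<le> x" using comp[OF \<open>v \<in> C\<close> \<open>x \<in> C\<close>] by (auto simp: order_le_less)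
      with \<open>u < v\<close> have "u < x" by (rule order.strict_trans2)
      then have "u < y" using \<open>x < y\<close> by (rule order.strict_trans)
      then have "coefficient x y = coefficient u y"
        using that by (intro right comp) auto
      also have "\<dots> = coefficient u v"
        using \<open>u < y\<close> that by (intro left comp) auto
      finally show ?thesis .
    qed
  qed
  show ?thesis
    unfolding constant_on_chains_def
  proof (intro allI impI ballI)
    fix C and x y u v :: 'p
    assume "Complete_Partial_Order.chain (\<le>) C" "x \<in> C" "y \<in> C" "u \<in> C" "v \<in> C" "x < y" "u < v"
    then have "coefficient x y = coefficient u v" by (rule chain)
    with \<open>x < y\<close> \<open>u < v\<close> show "(\<lambda>(x, y)\<in>strict_pairs. coefficient x y) (x, y)
        = (\<lambda>(x, y)\<in>strict_pairs. coefficient x y) (u, v)"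
      by (simp add: strict_pairs_def)
  qed
qed

section \<open>Biderivations with vanishing coefficients\<close>

text \<open>The crossed terms in the expansion of \<open>B (e\<^bsub>pp\<^esub> f e\<^bsub>qq\<^esub>, g)\<close> vanish at \<open>(p, q)\<close>.\<close>

lemma eval_eq_0_left:
  assumes coefficient: "\<And>x y. x < y \<Longrightarrow> coefficient x y = 0"
    and f: "f \<in> span_series" and g: "g \<in> span_series" and "p \<le> q"
    and p: "B (unit_series p p, g) p q = 0" and pq: "B (unit_series p q, g) p q = 0"
  shows "B (f, g) p q = 0"
proof -
  let ?e = "unit_series :: 'p \<Rightarrow> 'p \<Rightarrow> ('p, 'r) series"
  \<comment> \<open>For \<open>p \<noteq> q\<close> the product of the two idempotents is 0, so
    their values at \<open>(p, q)\<close> are opposite, and one of them vanishes by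
    hypothesis.\<close>
  have "B (?e p p \<star> ?e q q, g) = B (?e p p, g) \<star> ?e q q + ?e p p \<star> B (?e q q, g)"
    using g by (intro conv_left) auto
  then have "B (?e p p \<star> ?e q q, g) p q = B (?e p p, g) p q + B (?e q q, g) p q"
    using g by (simp add: unit_conv conv_unit)
  then have q: "B (?e q q, g) p q = 0"
    using p g by (cases "p = q") (simp_all add: unit_conv_unit)
  have left: "B (?e p p, g) p z = 0" if "z \<le> q" for z
    using that p g eval_not_maximal[of "?e p p" g z q p] coefficient by (auto simp: order_le_less)
  have right: "B (?e q q, g) z q = 0" if "p \<le> z" for z
    using that q g eval_not_minimal[of "?e q q" g p z q] coefficient by (auto simp: order_le_less)
  \<comment> \<open>Cutting \<open>f\<close> down to its entry at \<open>(p, q)\<close> leaves a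
    multiple of a unit on which the value is known to vanish, while the middle Leibniz term still
    shows \<open>B (f, g) p q\<close>.\<close>
  have eq: "?e p p \<star> (f \<star> ?e q q) = scale (f p q) (?e p q)"
    using f by (intro ext) (simp add: unit_conv conv_unit, simp add: scale_def)
  have "B (?e p p \<star> (f \<star> ?e q q), g) = B (?e p p, g) \<star> (f \<star> ?e q q)
      + ?e p p \<star> (B (f, g) \<star> ?e q q + f \<star> B (?e q q, g))"
    using f g by (simp add: conv_left)
  then have "B (?e p p \<star> (f \<star> ?e q q), g) p q = (B (?e p p, g) \<star> (f \<star> ?e q q)) p q
      + (B (f, g) p q + (f \<star> B (?e q q, g)) p q)"
    using f g by (simp add: unit_conv conv_unit)
  moreover have "B (?e p p \<star> (f \<star> ?e q q), g) p q = 0"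
    using g \<open>p \<le> q\<close> pq by (simp add: eq scale_left) (simp add: scale_def)
  moreover have "(B (?e p p, g) \<star> (f \<star> ?e q q)) p q = 0"
    by (rule ccontr, erule conv_nonzeroE) (use left in auto)
  moreover have "(f \<star> B (?e q q, g)) p q = 0"
    by (rule ccontr, erule conv_nonzeroE) (use right in auto)
  ultimately show ?thesis by simp
qed

text \<open>\<open>eval_eq_0_left\<close> reduces the first argument to the units at
  \<open>(p, p)\<close> and \<open>(p, q)\<close>; after \<open>swap\<close> it does the same for
  the second. On these units the value at \<open>(p, q)\<close> is, up to sign,
  \<open>coefficient p q\<close> or a value of \<open>B\<close> at equal arguments.\<close>

lemma eq_0_if_coefficient_eq_0:
  assumes coefficient: "\<And>x y. x < y \<Longrightarrow> coefficient x y = 0"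
    and f: "f \<in> span_series" and g: "g \<in> span_series"
  shows "B (f, g) = 0"
proof (intro ext)
  let ?e = "unit_series :: 'p \<Rightarrow> 'p \<Rightarrow> ('p, 'r) series"
  fix p q
  have "B (f, g) p q = 0" if "p \<le> q"
  proof -
    have eval: "B (h, k) p q = 0"
      if "h \<in> span_series" "k \<in> span_series"
        "B (?e p p, k) p q = 0" "B (?e p q, k) p q = 0" for h k
      by (rule eval_eq_0_left) (use that coefficient \<open>p \<le> q\<close> in auto)
    have "B (?e p p, ?e p q) p q = 0"
    proof (cases "p = q")
      case False
      with that show ?thesis using coefficient[of p q] by (simp add: coefficient_def)
    qed simp
    moreover from this have "B (?e p q, ?e p p) p q = 0"
      using that swap[of "?e p p" "?e p q"] by simp
    ultimately have "B (h, ?e p p) p q = 0" "B (h, ?e p q) p q = 0" if "h \<in> span_series" for h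
      using that \<open>p \<le> q\<close> eval[of h "?e p p"] eval[of h "?e p q"] by simp_all
    then have "B (?e p p, g) p q = 0" "B (?e p q, g) p q = 0"
      using g that swap[of g "?e p p"] swap[of g "?e p q"] by simp_all
    then show ?thesis by (rule eval[OF f g])
  qed
  then show "B (f, g) p q = 0 p q"
    using f g incidence_seriesD[of "B (f, g)" p q] by auto
qed

end

lemma antisymmetric_biderivation_diff:
  fixes B C :: "('p::order, 'r::{comm_ring,monoid_mult}) series \<times> ('p, 'r) series \<Rightarrow> ('p, 'r) series"
  assumes "antisymmetric_biderivation B" "antisymmetric_biderivation C"
  shows "antisymmetric_biderivation (\<lambda>x. B x - C x)"
proof -
  interpret B: antisymmetric_biderivation B by fact
  interpret C: antisymmetric_biderivation C by fact
  have scale_diff: "scale r (f - g) = scale r f - scale r g" for r and f g :: "('p, 'r) series"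
    by (simp add: scale_def fun_eq_iff right_diff_distrib)
  show ?thesis
  proof
    show "bilinear_on span_series (\<lambda>x. B x - C x)"
      by (simp add: bilinear_on_def B.add_left C.add_left B.add_right C.add_right
          B.scale_left C.scale_left B.scale_right C.scale_right scale_diff)
    show "antisymmetric_on span_series (\<lambda>x. B x - C x)"
      by (simp add: antisymmetric_on_def)
    show "biderivation span_series (\<star>) finitary_series (\<star>) (\<star>) (\<lambda>x. B x - C x)"
      by (auto simp: biderivation_def B.add_left C.add_left B.add_right C.add_right
          B.conv_left C.conv_left B.conv_right C.conv_right conv_distribs)
  qed
qed

section \<open>The biderivation of a map constant on chains\<close>

definition twist :: "('p::order \<times> 'p \<Rightarrow> 'r::comm_ring) \<Rightarrow> ('p, 'r) series \<Rightarrow> ('p, 'r) series" where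
  "twist \<sigma> f = (\<lambda>x y. if x < y then \<sigma> (x, y) * f x y else 0)"

lemma twist_add: "twist \<sigma> (f + g) = twist \<sigma> f + twist \<sigma> g"
  by (simp add: twist_def fun_eq_iff distrib_left)

lemma twist_scale: "twist \<sigma> (scale r f) = scale r (twist \<sigma> f)"
  by (simp add: twist_def scale_def fun_eq_iff mult.left_commute)

lemma finitary_twist [simp]:
  assumes "f \<in> finitary_series"
  shows "twist \<sigma> f \<in> finitary_series"
proof -
  have "finite {(u, v). x \<le> u \<and> u < v \<and> v \<le> y \<and> twist \<sigma> f u v \<noteq> 0}" for x y
    by (rule finite_subset[OF _ finite_finitary_support[OF assms]]) (auto simp: twist_def)
  moreover have "twist \<sigma> f \<in> incidence_series"
    by (rule incidence_seriesI) (auto simp: twist_def order_le_less)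
  ultimately show ?thesis by (rule finitary_seriesI[rotated])
qed

text \<open>Both pairs are taken from the chain \<open>{x, z, y}\<close>.\<close>

lemma constant_on_chainsD:
  assumes "constant_on_chains \<sigma>" "x \<le> z" "z \<le> y"
  shows "x < z \<Longrightarrow> \<sigma> (x, z) = \<sigma> (x, y)" "z < y \<Longrightarrow> \<sigma> (z, y) = \<sigma> (x, y)"
proof -
  have "x \<le> y" using assms(2,3) by (rule order.trans)
  then have chain: "Complete_Partial_Order.chain (\<le>) {x, z, y}"
    using assms(2,3) by (auto simp: chain_def)
  note eq = assms(1)[unfolded constant_on_chains_def, rule_format, OF chain]
  show "\<sigma> (x, z) = \<sigma> (x, y)" if "x < z"
    by (rule eq) (use that order.strict_trans2[OF that assms(3)] in simp_all)
  show "\<sigma> (z, y) = \<sigma> (x, y)" if "z < y"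
    by (rule eq) (use that order.strict_trans1[OF assms(2) that] in simp_all)
qed

text \<open>In a sum at \<open>x < y\<close>, a term with \<open>f\<close> on the diagonal is 0. In
  all others \<open>f\<close> sits at a strict pair sharing an end with \<open>(x, y)\<close> inside
  the interval, so its factor is \<open>\<sigma> (x, y)\<close> and can be pulled out of the
  sum.\<close>

lemma twist_conv:
  fixes f g :: "('p::order, 'r::comm_ring) series"
  assumes \<sigma>: "constant_on_chains \<sigma>"
    and f: "f \<in> finitary_series" and g: "g \<in> finitary_series" and diag: "\<And>x. f x x = 0"
  shows "twist \<sigma> f \<star> g = twist \<sigma> (f \<star> g)" "g \<star> twist \<sigma> f = twist \<sigma> (g \<star> f)"
proof -
  have eq: "(k \<star> l) x y = (\<Sum>z\<in>endpoints g x y. k x z * l z y)"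
    if "k \<in> finitary_series" "l \<in> finitary_series" "k = g \<or> l = g" for k l x y
    by (rule conv_eq_sum_endpoints[where x = x and y = y])
      (use f g that in \<open>auto simp: finite_endpoints endpoints_ends\<close>)
  \<comment> \<open>Off the strict pairs only a purely diagonal term could contribute, and one of
    its factors vanishes.\<close>
  have not_less: "(k \<star> l) x y = 0" if "\<not> x < y" "\<And>x. k x x = 0 \<or> l x x = 0"
    for k l :: "('p, 'r) series" and x y
  proof (rule ccontr)
    assume "(k \<star> l) x y \<noteq> 0"
    then obtain z where z: "x \<le> z" "z \<le> y" "k x z \<noteq> 0" "l z y \<noteq> 0" by (rule conv_nonzeroE)
    then have "x = z" "z = y" using that(1) by (auto simp: order_le_less)
    then show False using z(3,4) that(2) by auto
  qed
  show "twist \<sigma> f \<star> g = twist \<sigma> (f \<star> g)"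
  proof (intro ext)
    fix x y
    have "twist \<sigma> f x z * g z y = \<sigma> (x, y) * (f x z * g z y)" if "x < y" "z \<in> endpoints g x y" for z
    proof -
      have "x \<le> z" "z \<le> y" using endpoints_bounds[OF _ that(2)] that(1) by auto
      then show ?thesis
        using constant_on_chainsD(1)[OF \<sigma>, of x z y] by (auto simp: twist_def diag order_le_less mult.assoc)
    qed
    then have "x < y \<Longrightarrow> (twist \<sigma> f \<star> g) x y = \<sigma> (x, y) * (f \<star> g) x y"
      using f g by (simp add: eq sum_distrib_left)
    then show "(twist \<sigma> f \<star> g) x y = twist \<sigma> (f \<star> g) x y"
      using not_less[of x y "twist \<sigma> f" g] by (auto simp: twist_def)
  qed
  show "g \<star> twist \<sigma> f = twist \<sigma> (g \<star> f)"
  proof (intro ext)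
    fix x y
    have "g x z * twist \<sigma> f z y = \<sigma> (x, y) * (g x z * f z y)" if "x < y" "z \<in> endpoints g x y" for z
    proof -
      have "x \<le> z" "z \<le> y" using endpoints_bounds[OF _ that(2)] that(1) by auto
      then show ?thesis
        using constant_on_chainsD(2)[OF \<sigma>, of x z y]
        by (auto simp: twist_def diag order_le_less mult.left_commute)
    qed
    then have "x < y \<Longrightarrow> (g \<star> twist \<sigma> f) x y = \<sigma> (x, y) * (g \<star> f) x y"
      using f g by (simp add: eq sum_distrib_left)
    then show "(g \<star> twist \<sigma> f) x y = twist \<sigma> (g \<star> f) x y"
      using not_less[of x y g "twist \<sigma> f"] by (auto simp: twist_def)
  qed
qed

definition twisted_commutator ::
    "('p::order \<times> 'p \<Rightarrow> 'r::{comm_ring,monoid_mult}) \<Rightarrow>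
     ('p, 'r) series \<times> ('p, 'r) series \<Rightarrow> ('p, 'r) series" where
  "twisted_commutator \<sigma> = (\<lambda>(f, g) \<in> span_series \<times> span_series. twist \<sigma> (commutator f g))"

lemma twisted_commutator_apply:
  "f \<in> span_series \<Longrightarrow> g \<in> span_series \<Longrightarrow> twisted_commutator \<sigma> (f, g) = twist \<sigma> (commutator f g)"
  by (simp add: twisted_commutator_def)

text \<open>The commutator is itself a biderivation. By \<open>twist_conv\<close> twisting commutes
  with multiplication from either side on series with zero diagonal, and commutators are
  such.\<close>

lemma antisymmetric_biderivation_twisted_commutator:
  fixes \<sigma> :: "'p::order \<times> 'p \<Rightarrow> 'r::{comm_ring,monoid_mult}"
  assumes \<sigma>: "constant_on_chains \<sigma>"
  shows "antisymmetric_biderivation (twisted_commutator \<sigma>)"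
proof
  have add: "twisted_commutator \<sigma> (f + g, h) = twisted_commutator \<sigma> (f, h) + twisted_commutator \<sigma> (g, h)"
    "twisted_commutator \<sigma> (f, g + h) = twisted_commutator \<sigma> (f, g) + twisted_commutator \<sigma> (f, h)"
    if "f \<in> span_series" "g \<in> span_series" "h \<in> span_series" for f g h
    using that
    by (simp_all add: twisted_commutator_apply twist_add[symmetric] commutator_def conv_distribs algebra_simps)
  have "commutator (scale r f) g = scale r (commutator f g)"
       "commutator f (scale r g) = scale r (commutator f g)"
    if "f \<in> span_series" "g \<in> span_series" for r and f g :: "('p, 'r) series"
    unfolding commutator_def using that
    by (simp_all add: conv_scale) (simp_all add: scale_def fun_eq_iff right_diff_distrib)
  then have "twisted_commutator \<sigma> (scale r f, g) = scale r (twisted_commutator \<sigma> (f, g))"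
      "twisted_commutator \<sigma> (f, scale r g) = scale r (twisted_commutator \<sigma> (f, g))"
    if "f \<in> span_series" "g \<in> span_series" for r f g
    using that by (simp_all add: twisted_commutator_apply twist_scale)
  then show "bilinear_on span_series (twisted_commutator \<sigma>)"
    unfolding bilinear_on_def by (simp add: add)
  show "antisymmetric_on span_series (twisted_commutator \<sigma>)"
    by (auto simp: antisymmetric_on_def twisted_commutator_apply commutator_def twist_def fun_eq_iff)
  have left: "twisted_commutator \<sigma> (a \<star> b, c)
      = twisted_commutator \<sigma> (a, c) \<star> b + a \<star> twisted_commutator \<sigma> (b, c)"
    if "a \<in> span_series" "b \<in> span_series" "c \<in> span_series" for a b c
  proof -
    have "commutator (a \<star> b) c = commutator a c \<star> b + a \<star> commutator b c"
      using that by (simp add: commutator_def conv_distribs conv_assoc)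
    then show ?thesis
      using that by (simp add: twisted_commutator_apply twist_conv[OF \<sigma>] commutator_diagonal twist_add)
  qed
  have right: "twisted_commutator \<sigma> (a, b \<star> c)
      = twisted_commutator \<sigma> (a, b) \<star> c + b \<star> twisted_commutator \<sigma> (a, c)"
    if "a \<in> span_series" "b \<in> span_series" "c \<in> span_series" for a b c
  proof -
    have "commutator a (b \<star> c) = commutator a b \<star> c + b \<star> commutator a c"
      using that by (simp add: commutator_def conv_distribs conv_assoc)
    then show ?thesis
      using that by (simp add: twisted_commutator_apply twist_conv[OF \<sigma>] commutator_diagonal twist_add)
  qed
  show "biderivation span_series (\<star>) finitary_series (\<star>) (\<star>) (twisted_commutator \<sigma>)"
    unfolding biderivation_def by (auto simp: add left right) (simp add: twisted_commutator_apply)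
qed

section \<open>The bijective correspondence\<close>

lemma twisted_commutator_units:
  fixes \<sigma> :: "'p::order \<times> 'p \<Rightarrow> 'r::{comm_ring,monoid_mult}"
  shows "x < y \<Longrightarrow> twisted_commutator \<sigma> (unit_series x x, unit_series x y) x y = \<sigma> (x, y)"
  by (simp add: twisted_commutator_apply commutator_units twist_def)

text \<open>The difference of the two maps is again an antisymmetric biderivation. By
  \<open>twisted_commutator_units\<close> its coefficients are 0, so it vanishes on the span;
  extensionality settles the other arguments.\<close>

lemma twisted_commutator_coefficient:
  fixes B :: "('p::order, 'r::{comm_ring,monoid_mult}) series \<times> ('p, 'r) series \<Rightarrow> ('p, 'r) series"
  assumes B: "antisymmetric_biderivation B" and "B \<in> extensional (span_series \<times> span_series)"
  shows "twisted_commutator (\<lambda>(x, y)\<in>strict_pairs. antisymmetric_biderivation.coefficient B x y) = B"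
    (is "twisted_commutator ?\<sigma> = B")
proof -
  interpret B: antisymmetric_biderivation B by fact
  interpret T: antisymmetric_biderivation "twisted_commutator ?\<sigma>"
    by (intro antisymmetric_biderivation_twisted_commutator B.constant_on_chains_coefficient)
  interpret D: antisymmetric_biderivation "\<lambda>x. B x - twisted_commutator ?\<sigma> x"
    by (intro antisymmetric_biderivation_diff) unfold_locales
  have "D.coefficient x y = 0" if "x < y" for x y
    unfolding D.coefficient_def
    using that by (simp add: twisted_commutator_units B.coefficient_def strict_pairs_def)
  then have "B (f, g) - twisted_commutator ?\<sigma> (f, g) = 0" if "f \<in> span_series" "g \<in> span_series" for f g
    using that by (rule D.eq_0_if_coefficient_eq_0)
  moreover have "twisted_commutator ?\<sigma> \<in> extensional (span_series \<times> span_series)"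
    by (simp add: twisted_commutator_def)
  ultimately show ?thesis
    using assms(2) by (intro extensionalityI[of _ "span_series \<times> span_series"]) auto
qed

theorem theorem3p7:
  shows "bij_betw
    (\<lambda>\<sigma>. \<lambda>(f, g) \<in> span_series \<times> span_series.
       (\<lambda>x y. if x < y then \<sigma> (x, y) * commutator f g x y else 0))
    {\<sigma> :: 'p::order \<times> 'p \<Rightarrow> 'r::{comm_ring,monoid_mult}.
       \<sigma> \<in> strict_pairs \<rightarrow>\<^sub>E UNIV \<and> constant_on_chains \<sigma>}
    {B :: ('p, 'r) series \<times> ('p, 'r) series \<Rightarrow> ('p, 'r) series.
       B \<in> span_series \<times> span_series \<rightarrow>\<^sub>E finitary_series \<and>
       bilinear_on span_series B \<and>
       antisymmetric_on span_series B \<and>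
       biderivation span_series (\<star>) finitary_series (\<star>) (\<star>) B}"
    (is "bij_betw ?F ?S ?T")
proof -
  have F: "?F = twisted_commutator"
    by (simp add: twisted_commutator_def twist_def fun_eq_iff)
  \<comment> \<open>\<open>PiE\<close> splits into extensionality and finitary values, the latter
    being recorded by \<open>biderivation\<close>.\<close>
  have T: "?T = {B. antisymmetric_biderivation B \<and> B \<in> extensional (span_series \<times> span_series)}"
    by (auto simp: antisymmetric_biderivation_def PiE_def biderivation_def)
  show ?thesis
    unfolding F T
  proof (rule bij_betw_imageI)
    show "inj_on twisted_commutator ?S"
    proof (rule inj_onI)
      fix \<sigma> \<tau> :: "'p \<times> 'p \<Rightarrow> 'r"
      assume mem: "\<sigma> \<in> ?S" "\<tau> \<in> ?S" and eq: "twisted_commutator \<sigma> = twisted_commutator \<tau>"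
      have "\<sigma> (x, y) = \<tau> (x, y)" if "x < y" for x y
        using twisted_commutator_units[OF that, of \<sigma>] twisted_commutator_units[OF that, of \<tau>] eq by simp
      then show "\<sigma> = \<tau>"
        using mem by (intro PiE_ext[of _ strict_pairs "\<lambda>_. UNIV"]) (auto simp: strict_pairs_def)
    qed
    show "twisted_commutator ` ?S
        = {B. antisymmetric_biderivation B \<and> B \<in> extensional (span_series \<times> span_series)}"
    proof (intro equalityI subsetI)
      fix B :: "('p, 'r) series \<times> ('p, 'r) series \<Rightarrow> ('p, 'r) series"
      assume "B \<in> twisted_commutator ` ?S"
      then show "B \<in> {B. antisymmetric_biderivation B \<and> B \<in> extensional (span_series \<times> span_series)}"
        using antisymmetric_biderivation_twisted_commutator by (auto simp: twisted_commutator_def)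
    next
      fix B :: "('p, 'r) series \<times> ('p, 'r) series \<Rightarrow> ('p, 'r) series"
      assume "B \<in> {B. antisymmetric_biderivation B \<and> B \<in> extensional (span_series \<times> span_series)}"
      then have B: "antisymmetric_biderivation B" "B \<in> extensional (span_series \<times> span_series)" by auto
      show "B \<in> twisted_commutator ` ?S"
      proof (rule image_eqI)
        show "B = twisted_commutator
            (\<lambda>(x, y)\<in>strict_pairs. antisymmetric_biderivation.coefficient B x y)"
          by (rule twisted_commutator_coefficient[OF B, symmetric])
        show "(\<lambda>(x, y)\<in>strict_pairs. antisymmetric_biderivation.coefficient B x y) \<in> ?S"
          using antisymmetric_biderivation.constant_on_chains_coefficient[OF B(1)] by simp
      qed
    qed
  qed
qed

end
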